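(* For any finite set $\mathit{AP}$ of atomic propositions, subset $I \subseteq \mathit{AP}$, and bound $k \in \mathbb{N}$, there is a deterministic finite automaton $\mathcal{A}_k$ over the alphabet $\Sigma = 2^{\mathit{AP}}$ with $(2^{|I|}+1)^k \cdot (k+1)^k$ states such that $L(\mathcal{A}_k) = \{ w \in \Sigma^* \mid \exists \sigma \in L_k^I(\Sigma^\omega).\ w \text{ is a prefix of } \sigma\}$.
   Context: For $\sigma \in \Sigma^\omega$, $\sigma|_I \in (2^I)^\omega$ is its projection onto $I$. $L_k^I(\Sigma^\omega)$ is the set of all $\sigma \in \Sigma^\omega$ for which there exist finite words $u \in (2^I)^*$ and $v \in (2^I)^+$ with $|u \cdot v| = k$ and $\sigma|_I = u \cdot v^\omega$. A deterministic finite automaton has a single initial state, a total transition function $\delta : Q \times \Sigma \to Q$ and a set of accepting states; $L(\mathcal{A}_k)$ is the set of finite words it accepts. *)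

theory Defs
  imports Main "HOL-Library.Omega_Words_Fun"
begin

definition omega_words :: "'a set \<Rightarrow> 'a word set" where
  "omega_words \<Sigma> = {\<sigma>. \<forall>n. \<sigma> n \<in> \<Sigma>}"

definition proj :: "'p set \<Rightarrow> 'p set word \<Rightarrow> 'p set word" where
  "proj I \<sigma> = (\<lambda>n. \<sigma> n \<inter> I)"

definition lasso_words :: "'p set \<Rightarrow> nat \<Rightarrow> 'p set set \<Rightarrow> 'p set word set" where
  "lasso_words I k \<Sigma> =
     {\<sigma> \<in> omega_words \<Sigma>. \<exists>u v. u \<in> lists (Pow I) \<and> v \<in> lists (Pow I) \<and> v \<noteq> [] \<and>
        length (u @ v) = k \<and> proj I \<sigma> = u \<frown> v\<^sup>\<omega>}"

record ('q, 'a) dfa =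
  states :: "'q set"
  init :: 'q
  trans :: "'q \<Rightarrow> 'a \<Rightarrow> 'q"
  accepting :: "'q set"

text \<open>Totality of the transition function amounts to closure of the state set under
  \<open>trans\<close>: values of \<open>trans\<close> outside \<open>states \<times> \<Sigma>\<close> are irrelevant.\<close>

definition is_dfa :: "'a set \<Rightarrow> ('q, 'a) dfa \<Rightarrow> bool" where
  "is_dfa \<Sigma> A \<longleftrightarrow>
     finite (states A) \<and> init A \<in> states A \<and> accepting A \<subseteq> states A \<and>
     (\<forall>q \<in> states A. \<forall>a \<in> \<Sigma>. trans A q a \<in> states A)"

definition language :: "'a set \<Rightarrow> ('q, 'a) dfa \<Rightarrow> 'a list set" where
  "language \<Sigma> A = {w \<in> lists \<Sigma>. foldl (trans A) (init A) w \<in> accepting A}"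

end

theory Submission
  imports Defs
begin

text \<open>After reading \<open>w\<close> it suffices to remember the first \<open>k\<close> projected letters (padded with a
  blank while \<open>w\<close> is shorter than \<open>k\<close>) and, for each possible loop start \<open>i < k\<close>, either the
  position in the lasso that the next letter has to match or the value \<open>k\<close>, meaning that \<open>w\<close>
  already contradicts a loop starting at \<open>i\<close>. This summary determines both acceptance and the summary
  of every one-letter extension, so it is the state of a deterministic automaton.\<close>

text \<open>A Myhill-Nerode construction: \<open>step\<close> makes equality of \<open>f\<close> a
  right congruence on \<open>lists \<Sigma>\<close>, and \<open>acc\<close> makes \<open>L\<close> a
  union of its classes. The classes are numbered through a bijection from all of \<open>S\<close>,
  so the state count is \<open>card S\<close> even if \<open>f\<close> misses part of
  \<open>S\<close>.\<close>

lemma dfa_of_summary: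
  fixes f :: "'a list \<Rightarrow> 's" and L :: "'a list set"
  assumes fin: "finite S" and range: "\<And>w. w \<in> lists \<Sigma> \<Longrightarrow> f w \<in> S"
    and step: "\<And>w w' a. w \<in> lists \<Sigma> \<Longrightarrow> w' \<in> lists \<Sigma> \<Longrightarrow> a \<in> \<Sigma> \<Longrightarrow> f w = f w' \<Longrightarrow>
      f (w @ [a]) = f (w' @ [a])"
    and acc: "\<And>w w'. w \<in> lists \<Sigma> \<Longrightarrow> w' \<in> lists \<Sigma> \<Longrightarrow> f w = f w' \<Longrightarrow> w \<in> L \<Longrightarrow> w' \<in> L"
    and L: "L \<subseteq> lists \<Sigma>"
  shows "\<exists>A :: (nat, 'a) dfa. is_dfa \<Sigma> A \<and> card (states A) = card S \<and> language \<Sigma> A = L"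
proof -
  obtain e where e: "bij_betw e S {0..<card S}"
    using ex_bij_betw_finite_nat[OF fin] by blast
  define h where "h w = e (f w)" for w
  have h_S: "h w \<in> {0..<card S}" if "w \<in> lists \<Sigma>" for w
    using bij_betwE[OF e] range[OF that] unfolding h_def by blast
  have h_eq: "f w = f w'" if "w \<in> lists \<Sigma>" "w' \<in> lists \<Sigma>" "h w = h w'" for w w'
    using bij_betw_imp_inj_on[OF e] range that unfolding h_def by (meson inj_onD)
  define rep where "rep q = (SOME w. w \<in> lists \<Sigma> \<and> h w = q)" for q
  \<comment> \<open>A number that no word reaches gets a self-loop, which keeps the state set
    closed. On reached numbers the choice made by \<open>rep\<close> does not matter, by
    \<open>step\<close>.\<close>
  define tr where "tr q a = (if \<exists>w \<in> lists \<Sigma>. h w = q then h (rep q @ [a]) else q)" for q a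
  define A where "A = \<lparr>states = {0..<card S}, init = h [], trans = tr, accepting = h ` L\<rparr>"
  have rep: "rep (h w) \<in> lists \<Sigma> \<and> h (rep (h w)) = h w" if "w \<in> lists \<Sigma>" for w
    unfolding rep_def by (rule someI[of _ w]) (use that in simp)
  have tr: "tr (h w) a = h (w @ [a])" if "w \<in> lists \<Sigma>" "a \<in> \<Sigma>" for w a
  proof -
    have "f (rep (h w)) = f w" using rep[OF that(1)] h_eq that(1) by blast
    hence "f (rep (h w) @ [a]) = f (w @ [a])" using step rep[OF that(1)] that by blast
    thus ?thesis using that unfolding tr_def h_def by auto
  qed
  have run: "foldl tr (h []) w = h w" if "w \<in> lists \<Sigma>" for w
    using that by (induction w rule: rev_induct) (auto simp: tr)
  have tr_S: "tr q a \<in> {0..<card S}" if "q \<in> {0..<card S}" "a \<in> \<Sigma>" for q a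
  proof (cases "\<exists>w \<in> lists \<Sigma>. h w = q")
    case True
    then obtain w where w: "w \<in> lists \<Sigma>" "h w = q" by blast
    have "w @ [a] \<in> lists \<Sigma>" using w that by simp
    from h_S[OF this] show ?thesis using tr[OF w(1) that(2)] w by simp
  next
    case False
    thus ?thesis using that by (simp add: tr_def)
  qed
  have "h ` L \<subseteq> {0..<card S}" using L h_S by blast
  hence "is_dfa \<Sigma> A"
    using h_S[of "[]"] tr_S unfolding is_dfa_def A_def by auto
  moreover have "language \<Sigma> A = L"
  proof (intro set_eqI iffI)
    fix w assume "w \<in> language \<Sigma> A"
    hence "w \<in> lists \<Sigma>" "foldl tr (h []) w \<in> h ` L" unfolding language_def A_def by auto
    hence w: "w \<in> lists \<Sigma>" "h w \<in> h ` L" by (simp_all only: run)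
    then obtain w' where "w' \<in> L" "h w = h w'" by blast
    thus "w \<in> L" using acc[of w' w] h_eq[of w' w] w L by auto
  next
    fix w assume "w \<in> L"
    thus "w \<in> language \<Sigma> A" using run L unfolding language_def A_def by auto
  qed
  ultimately show ?thesis by (intro exI[of _ A]) (simp add: A_def)
qed

text \<open>The position in \<open>u @ v\<close>, where \<open>length u = i\<close> and \<open>length (u @ v) = k\<close>, of the \<open>n\<close>-th
  letter of \<open>u \<frown> v\<^sup>\<omega>\<close>.\<close>

definition lasso_pos :: "nat \<Rightarrow> nat \<Rightarrow> nat \<Rightarrow> nat" where
  "lasso_pos k i n = (if n < k then n else i + (n - i) mod (k - i))"

lemma lasso_pos_less: "i < k \<Longrightarrow> lasso_pos k i n < k"
  using mod_less_divisor[of "k - i" "n - i"] unfolding lasso_pos_def by (split if_split) arith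

lemma lasso_pos_le: "i < k \<Longrightarrow> lasso_pos k i n \<le> n"
  using mod_less_eq_dividend[of "n - i" "k - i"] unfolding lasso_pos_def by (split if_split) arith

lemma lasso_pos_below: "n < k \<Longrightarrow> lasso_pos k i n = n"
  by (simp add: lasso_pos_def)

text \<open>From \<open>k\<close> on, the successor depends on the current position alone and not on
  \<open>n\<close>, so an automaton can track it without counting letters.\<close>

lemma lasso_pos_Suc:
  assumes "i < k" "k \<le> n"
  shows "lasso_pos k i (Suc n) =
    (if Suc (lasso_pos k i n) = k then i else Suc (lasso_pos k i n))"
  using assms by (auto simp: lasso_pos_def Suc_diff_le mod_Suc)

lemma conc_iter_nth:
  assumes "v \<noteq> []"
  shows "(u \<frown> v\<^sup>\<omega>) n = (u @ v) ! lasso_pos (length (u @ v)) (length u) n"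
  using assms by (auto simp: conc_def iter_def lasso_pos_def nth_append)

text \<open>No lasso is mentioned: for \<open>i < k\<close> the lasso position of \<open>j\<close>
  is at most \<open>j\<close>, so \<open>x\<close> can be compared with its own first
  \<open>k\<close> letters, which play the part of \<open>u @ v\<close>.\<close>

definition loop_consistent :: "nat \<Rightarrow> nat \<Rightarrow> 'a list \<Rightarrow> bool" where
  "loop_consistent k i x \<longleftrightarrow> (\<forall>j < length x. x ! j = x ! lasso_pos k i j)"

definition loop_status :: "nat \<Rightarrow> 'a list \<Rightarrow> nat \<Rightarrow> nat" where
  "loop_status k x i = (if loop_consistent k i x then lasso_pos k i (length x) else k)"

definition summary :: "nat \<Rightarrow> 'a list \<Rightarrow> 'a option list \<times> nat list" where
  "summary k x = (take k (map Some x @ replicate k None), map (loop_status k x) [0..<k])"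

lemma loop_status_less_iff: "i < k \<Longrightarrow> loop_status k x i < k \<longleftrightarrow> loop_consistent k i x"
  by (simp add: loop_status_def lasso_pos_less)

text \<open>All lasso positions are below \<open>k\<close>, hence already inside \<open>x\<close>.
  The new letter leaves the old comparisons intact and adds exactly one.\<close>

lemma loop_consistent_snoc:
  assumes "i < k" "k \<le> length x"
  shows "loop_consistent k i (x @ [a]) \<longleftrightarrow>
    loop_consistent k i x \<and> a = x ! lasso_pos k i (length x)"
proof -
  have "lasso_pos k i j < length x" for j
    using lasso_pos_less[OF assms(1), of j] assms(2) by simp
  thus ?thesis
    by (auto simp: loop_consistent_def nth_append less_Suc_eq)
qed

lemma summary_eq_status:
  assumes "summary k x = summary k y" "i < k"
  shows "loop_status k x i = loop_status k y i"
  using assms by (auto simp: summary_def)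

text \<open>Dropping the blanks from the first component gives back \<open>take k x\<close>. If this
  is shorter than \<open>k\<close>, it is the whole word; otherwise both words are long enough for
  the update rules above.\<close>

lemma summary_eq_cases:
  assumes "summary k x = summary k y"
  obtains "x = y" | "k \<le> length x" "k \<le> length y" "take k x = take k y"
proof -
  let ?p = "\<lambda>x. take k (map Some x @ replicate k None)"
  have eq: "?p x = ?p y" using assms by (simp add: summary_def)
  have the: "map the (filter (\<lambda>z. z \<noteq> None) (?p z)) = take k z" for z :: "'a list"
    by (simp add: take_map comp_def)
  have tk: "take k x = take k y" using the[of x] the[of y] unfolding eq by (rule trans[OF sym])
  hence "min (length x) k = min (length y) k" by (metis length_take)
  then consider "length x < k" "length y < k" | "k \<le> length x" "k \<le> length y" by linarith
  thus thesis using that tk by cases auto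
qed

lemma summary_snoc:
  assumes "summary k x = summary k y"
  shows "summary k (x @ [a]) = summary k (y @ [a])"
  using assms
proof (cases rule: summary_eq_cases)
  case 2
  have "loop_status k (x @ [a]) i = loop_status k (y @ [a]) i" if i: "i < k" for i
  proof -
    have st: "loop_status k x i = loop_status k y i"
      using summary_eq_status[OF assms i] .
    have con: "loop_consistent k i x = loop_consistent k i y"
      using loop_status_less_iff[OF i] st by metis
    show ?thesis
    proof (cases "loop_consistent k i x")
      case True
      \<comment> \<open>The lengths of \<open>x\<close> and \<open>y\<close> may differ, but for a
        consistent loop the status is the position itself.\<close>
      hence pos: "lasso_pos k i (length x) = lasso_pos k i (length y)"
        using st con by (simp add: loop_status_def)
      \<comment> \<open>The letter to be matched is among the first \<open>k\<close>, where
        \<open>x\<close> and \<open>y\<close> agree.\<close>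
      have "x ! lasso_pos k i (length x) = y ! lasso_pos k i (length x)"
        using 2(3) lasso_pos_less[OF i] by (metis nth_take)
      thus ?thesis
        using True con pos 2 i
        by (simp add: loop_status_def loop_consistent_snoc lasso_pos_Suc)
    next
      case False
      thus ?thesis using con 2 i by (simp add: loop_status_def loop_consistent_snoc)
    qed
  qed
  thus ?thesis using 2 by (simp add: summary_def take_map)
qed simp

text \<open>A full product rather than the range of \<open>summary\<close>, so that its cardinality
  is exactly the required number of states.\<close>

definition summaries :: "nat \<Rightarrow> 'a set \<Rightarrow> ('a option list \<times> nat list) set" where
  "summaries k B = {p. set p \<subseteq> insert None (Some ` B) \<and> length p = k} \<times>
     {s. set s \<subseteq> {..k} \<and> length s = k}"

lemma finite_summaries: "finite B \<Longrightarrow> finite (summaries k B)"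
  by (simp add: summaries_def finite_lists_length_eq)

lemma card_summaries:
  assumes "finite B"
  shows "card (summaries k B) = (card B + 1) ^ k * (k + 1) ^ k"
proof -
  have "card (insert None (Some ` B)) = card B + 1"
    using assms by (simp add: card_image)
  thus ?thesis using assms
    by (simp add: summaries_def card_cartesian_product card_lists_length_eq)
qed

lemma summary_in_summaries:
  assumes "x \<in> lists B"
  shows "summary k x \<in> summaries k B"
proof -
  have "loop_status k x i \<le> k" if "i < k" for i
    using lasso_pos_less[OF that] by (simp add: loop_status_def less_imp_le)
  thus ?thesis using assms
    by (auto simp: summary_def summaries_def dest!: in_set_takeD)
qed

lemma lasso_word_prefix_iff:
  assumes I: "I \<subseteq> AP" and w: "w \<in> lists (Pow AP)"
  shows "(\<exists>\<sigma> \<in> lasso_words I k (Pow AP). \<exists>n. w = prefix n \<sigma>) \<longleftrightarrow>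
    (\<exists>i < k. loop_consistent k i (map (\<lambda>a. a \<inter> I) w))"
proof
  let ?x = "map (\<lambda>a. a \<inter> I) w"
  assume "\<exists>\<sigma> \<in> lasso_words I k (Pow AP). \<exists>n. w = prefix n \<sigma>"
  then obtain \<sigma> u v where n: "w = prefix (length w) \<sigma>" and v: "v \<noteq> []" and k: "length (u @ v) = k"
    and pr: "proj I \<sigma> = u \<frown> v\<^sup>\<omega>"
    unfolding lasso_words_def by auto
  let ?i = "length u"
  have i: "?i < k" using v k by auto
  have x: "?x ! j = (u @ v) ! lasso_pos k ?i j" if "j < length w" for j
  proof -
    have "w ! j = \<sigma> j" using n that by (metis subsequence_nth add_0 diff_zero subsequence_length)
    hence "?x ! j = proj I \<sigma> j" using that by (simp add: proj_def)
    thus ?thesis using conc_iter_nth[OF v, of u j] pr k by simp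
  qed
  have "?x ! j = ?x ! lasso_pos k ?i j" if "j < length w" for j
  proof -
    have "lasso_pos k ?i j < length w" using lasso_pos_le[OF i, of j] that by simp
    \<comment> \<open>Positions below \<open>k\<close> are fixed by \<open>lasso_pos k ?i\<close>,
      so \<open>j\<close> and its lasso position show the same entry of
      \<open>u @ v\<close>.\<close>
    thus ?thesis
      using x that lasso_pos_below[OF lasso_pos_less[OF i]] by metis
  qed
  thus "\<exists>i < k. loop_consistent k i ?x" using i by (auto simp: loop_consistent_def)
next
  let ?x = "map (\<lambda>a. a \<inter> I) w"
  assume "\<exists>i < k. loop_consistent k i ?x"
  then obtain i where i: "i < k" and c: "loop_consistent k i ?x" by blast
  \<comment> \<open>If \<open>w\<close> is shorter than \<open>k\<close>, the lasso is completed
    with the letter \<open>{}\<close>, which lies in \<open>Pow I\<close>.\<close>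
  define y where "y = take k (?x @ replicate k {})"
  define u v where "u = take i y" and "v = drop i y"
  have y: "length y = k" "y \<in> lists (Pow I)" by (auto simp: y_def dest!: in_set_takeD)
  have uv: "u @ v = y" "length u = i" "v \<noteq> []" "u \<in> lists (Pow I)" "v \<in> lists (Pow I)"
    using y i by (auto simp: u_def v_def dest!: in_set_takeD in_set_dropD)
  have nth: "(u \<frown> v\<^sup>\<omega>) n = y ! lasso_pos k i n" for n
    using conc_iter_nth[OF uv(3), of u n] uv y by simp
  \<comment> \<open>Inside \<open>w\<close> the original letters stay, including their propositions
    outside \<open>I\<close>. Beyond \<open>w\<close> the lasso itself continues: its letters are
    subsets of \<open>I\<close>, so projection does not change them.\<close>
  define \<sigma> where "\<sigma> n = (if n < length w then w ! n else (u \<frown> v\<^sup>\<omega>) n)" for n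
  have yI: "y ! lasso_pos k i n \<subseteq> I" for n
    using y lasso_pos_less[OF i, of n] nth_mem[of "lasso_pos k i n" y] by auto
  have "proj I \<sigma> n = (u \<frown> v\<^sup>\<omega>) n" for n
  proof (cases "n < length w")
    case True
    have "lasso_pos k i n < length w" using lasso_pos_le[OF i, of n] True by simp
    moreover have "lasso_pos k i n < k" using lasso_pos_less[OF i] .
    ultimately have "y ! lasso_pos k i n = ?x ! lasso_pos k i n"
      by (simp add: y_def nth_append)
    also have "\<dots> = ?x ! n" using c True by (simp add: loop_consistent_def)
    finally show ?thesis using True nth by (simp add: proj_def \<sigma>_def)
  next
    case False
    thus ?thesis using yI[of n] by (auto simp: proj_def \<sigma>_def nth)
  qed
  hence "proj I \<sigma> = u \<frown> v\<^sup>\<omega>" by blast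
  moreover have "\<sigma> n \<in> Pow AP" for n
    using w I yI[of n] nth_mem[of n w] by (auto simp: \<sigma>_def nth)
  moreover have "length (u @ v) = k" using uv(1) y(1) by simp
  ultimately have "\<sigma> \<in> lasso_words I k (Pow AP)"
    using uv(3-5) unfolding lasso_words_def omega_words_def mem_Collect_eq by blast
  moreover have "w = prefix (length w) \<sigma>"
    by (rule nth_equalityI) (auto simp: \<sigma>_def)
  ultimately show "\<exists>\<sigma> \<in> lasso_words I k (Pow AP). \<exists>n. w = prefix n \<sigma>" by blast
qed

theorem theorem2:
  fixes AP I :: "'p set" and k :: nat
  assumes "finite AP" and "I \<subseteq> AP"
  shows "\<exists>A :: (nat, 'p set) dfa.
    is_dfa (Pow AP) A \<and>
    card (states A) = (2 ^ card I + 1) ^ k * (k + 1) ^ k \<and>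
    language (Pow AP) A =
      {w \<in> lists (Pow AP). \<exists>\<sigma> \<in> lasso_words I k (Pow AP). \<exists>n. w = prefix n \<sigma>}"
proof -
  let ?L = "{w \<in> lists (Pow AP). \<exists>\<sigma> \<in> lasso_words I k (Pow AP). \<exists>n. w = prefix n \<sigma>}"
  define f where "f w = summary k (map (\<lambda>a. a \<inter> I) w)" for w
  have "finite I" using assms finite_subset by blast
  hence fin: "finite (Pow I)" and card: "card (Pow I) = 2 ^ card I" by (auto simp: card_Pow)
  have "\<exists>A :: (nat, 'p set) dfa. is_dfa (Pow AP) A \<and>
    card (states A) = card (summaries k (Pow I)) \<and> language (Pow AP) A = ?L"
  proof (rule dfa_of_summary[where f = f])
    show "finite (summaries k (Pow I))" using fin by (rule finite_summaries)
    show "f w \<in> summaries k (Pow I)" for w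
      unfolding f_def by (rule summary_in_summaries) auto
    show "f (w @ [a]) = f (w' @ [a])" if "f w = f w'" for w w' a
      using summary_snoc that by (simp add: f_def)
    \<comment> \<open>Acceptance can be read off the summary: some loop start has a status below
      \<open>k\<close>.\<close>
    show "w' \<in> ?L" if w': "w' \<in> lists (Pow AP)" "f w = f w'" and w: "w \<in> ?L" for w w'
    proof -
      obtain i where i: "i < k" "loop_consistent k i (map (\<lambda>a. a \<inter> I) w)"
        using w lasso_word_prefix_iff[OF assms(2)] by blast
      have "loop_consistent k i (map (\<lambda>a. a \<inter> I) w')"
        using i summary_eq_status[OF w'(2)[unfolded f_def] i(1)] loop_status_less_iff by metis
      thus ?thesis using i(1) w'(1) lasso_word_prefix_iff[OF assms(2) w'(1)] by blast
    qed
  qed auto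
  thus ?thesis using card_summaries[OF fin] card by simp
qed

end
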